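(* Let $X$ and $Y$ be infinite-dimensional Banach spaces over $\mathbb{C}$, with $Y=Z'$ the dual of a normed linear space $Z$, and let $T\in B(X,Y)$. Let $(P_n)$ be a sequence in $B(X)$ with $\|P_n\|\le1$ for each $n\in\mathbb{N}$, put $T_n:=TP_n$, and suppose $T_n\to T$ as $n\to\infty$ in the weak$^*$ sense of convergence. Then for each $k\in\mathbb{N}$, $$\lim_{n\to\infty}c_k(T_n)=c_k(T).$$
   Context: $B(X,Y)$ is the space of bounded linear operators from $X$ to $Y$ with the operator norm, $B(X)=B(X,X)$ and $X'=B(X,\mathbb{C})$. For $k\in\mathbb{N}=\{1,2,\dots\}$, the $k$-th Gelfand number of $T\in B(X,Y)$ is $c_k(T)=\inf\{\|TJ_M^X\| : M\text{ a subspace of }X,\ \operatorname{codim}(M)<k\}$, where $J_M^X$ denotes the canonical injection from $M$ into $X$. When $Y=Z'$, a sequence $(T_n)$ in $B(X,Y)$ converges to $T$ in the weak$^*$ sense if for each $x\in X$ and $z\in Z$, $|(T_nx)(z)-(Tx)(z)|\to0$. *)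

theory Defs
  imports "HOL-Analysis.Analysis" "HOL-Library.Extended_Nat"
begin

section \<open>Complex normed spaces\<close>

class complex_normed_vector = real_normed_vector +
  fixes scaleC :: "complex \<Rightarrow> 'a \<Rightarrow> 'a"  (infixr "*\<^sub>C" 75)
  assumes scaleC_add_right: "c *\<^sub>C (x + y) = c *\<^sub>C x + c *\<^sub>C y"
    and scaleC_add_left: "(c + d) *\<^sub>C x = c *\<^sub>C x + d *\<^sub>C x"
    and scaleC_scaleC: "c *\<^sub>C (d *\<^sub>C x) = (c * d) *\<^sub>C x"
    and scaleC_of_real: "complex_of_real r *\<^sub>C x = r *\<^sub>R x"
    and norm_scaleC: "norm (c *\<^sub>C x) = cmod c * norm x"

class complex_banach = complex_normed_vector + complete_space

subclass (in complex_banach) banach ..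

lemma vector_space_scaleC:
  "vector_space (scaleC :: complex \<Rightarrow> 'a \<Rightarrow> 'a::complex_normed_vector)"
  using scaleC_of_real[of 1]
  by unfold_locales (auto simp: scaleC_add_right scaleC_add_left scaleC_scaleC)

global_interpretation cvec: vector_space
  "scaleC :: complex \<Rightarrow> 'a \<Rightarrow> 'a::complex_normed_vector"
  by (rule vector_space_scaleC)

instantiation complex :: complex_banach
begin

definition scaleC_complex :: "complex \<Rightarrow> complex \<Rightarrow> complex"
  where "scaleC_complex c x = c * x"

instance
  by standard (simp_all add: scaleC_complex_def algebra_simps norm_mult scaleR_conv_of_real)

end


section \<open>Bounded complex-linear operators and the dual space\<close>

typedef (overloaded) ('a, 'b) cblinfun =
  "{f :: 'a::complex_normed_vector \<Rightarrow>\<^sub>L 'b::complex_normed_vector.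
      \<forall>c x. blinfun_apply f (c *\<^sub>C x) = c *\<^sub>C blinfun_apply f x}"
  by (rule exI[of _ 0]) (simp add: zero_blinfun.rep_eq)

setup_lifting type_definition_cblinfun

text \<open>The norm is inherited from the type of bounded real-linear maps, where it is the operator norm.\<close>

instantiation cblinfun :: (complex_normed_vector, complex_normed_vector) complex_normed_vector
begin

lift_definition zero_cblinfun :: "('a, 'b) cblinfun" is 0 by simp

lift_definition plus_cblinfun :: "('a, 'b) cblinfun \<Rightarrow> ('a, 'b) cblinfun \<Rightarrow> ('a, 'b) cblinfun"
  is "(+)" by (simp add: plus_blinfun.rep_eq scaleC_add_right)

lift_definition minus_cblinfun :: "('a, 'b) cblinfun \<Rightarrow> ('a, 'b) cblinfun \<Rightarrow> ('a, 'b) cblinfun"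
  is "(-)" by (simp add: minus_blinfun.rep_eq cvec.scale_right_diff_distrib)

lift_definition uminus_cblinfun :: "('a, 'b) cblinfun \<Rightarrow> ('a, 'b) cblinfun"
  is uminus by (simp add: uminus_blinfun.rep_eq)

lift_definition scaleR_cblinfun :: "real \<Rightarrow> ('a, 'b) cblinfun \<Rightarrow> ('a, 'b) cblinfun"
  is scaleR by (simp add: scaleR_blinfun.rep_eq scaleC_scaleC mult.commute flip: scaleC_of_real)

lemma bounded_linear_scaleC: "bounded_linear (scaleC c :: 'c::complex_normed_vector \<Rightarrow> 'c)"
  by (rule bounded_linear_intro[where K = "cmod c"])
     (simp_all add: scaleC_add_right norm_scaleC scaleC_scaleC mult.commute flip: scaleC_of_real)

lift_definition scaleC_cblinfun :: "complex \<Rightarrow> ('a, 'b) cblinfun \<Rightarrow> ('a, 'b) cblinfun"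
  is "\<lambda>c f. Blinfun (scaleC c) o\<^sub>L f"
  by (simp add: bounded_linear_Blinfun_apply[OF bounded_linear_scaleC] scaleC_scaleC mult.commute)

lift_definition norm_cblinfun :: "('a, 'b) cblinfun \<Rightarrow> real" is norm .

definition sgn_cblinfun :: "('a, 'b) cblinfun \<Rightarrow> ('a, 'b) cblinfun"
  where "sgn_cblinfun f = scaleR (inverse (norm f)) f"

definition dist_cblinfun :: "('a, 'b) cblinfun \<Rightarrow> ('a, 'b) cblinfun \<Rightarrow> real"
  where "dist_cblinfun f g = norm (f - g)"

definition uniformity_cblinfun :: "(('a, 'b) cblinfun \<times> ('a, 'b) cblinfun) filter"
  where "uniformity_cblinfun = (INF e\<in>{0 <..}. principal {(f, g). dist f g < e})"

definition open_cblinfun :: "('a, 'b) cblinfun set \<Rightarrow> bool"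
  where "open_cblinfun S \<longleftrightarrow> (\<forall>f\<in>S. \<forall>\<^sub>F (g, h) in uniformity. g = f \<longrightarrow> h \<in> S)"

instance
proof
  fix f g h :: "('a, 'b) cblinfun" and r s :: real and c d :: complex and S :: "('a, 'b) cblinfun set"
  note * = bounded_linear_Blinfun_apply[OF bounded_linear_scaleC]
  show "f + g + h = f + (g + h)" by transfer simp
  show "f + g = g + f" by transfer simp
  show "0 + f = f" by transfer simp
  show "- f + f = 0" by transfer simp
  show "f - g = f + - g" by transfer simp
  show "r *\<^sub>R (f + g) = r *\<^sub>R f + r *\<^sub>R g" by transfer (simp add: scaleR_add_right)
  show "(r + s) *\<^sub>R f = r *\<^sub>R f + s *\<^sub>R f" by transfer (simp add: scaleR_add_left)
  show "r *\<^sub>R s *\<^sub>R f = (r * s) *\<^sub>R f" by transfer simp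
  show "1 *\<^sub>R f = f" by transfer simp
  show "dist f g = norm (f - g)" by (rule dist_cblinfun_def)
  show "sgn f = scaleR (inverse (norm f)) f" by (rule sgn_cblinfun_def)
  show "uniformity = (INF e\<in>{0 <..}. principal {(f, g :: ('a, 'b) cblinfun). dist f g < e})"
    by (rule uniformity_cblinfun_def)
  show "open S \<longleftrightarrow> (\<forall>f\<in>S. \<forall>\<^sub>F (g, h) in uniformity. g = f \<longrightarrow> h \<in> S)"
    by (rule open_cblinfun_def)
  show "norm f = 0 \<longleftrightarrow> f = 0" by transfer simp
  show "norm (f + g) \<le> norm f + norm g" by transfer (rule norm_triangle_ineq)
  show "norm (r *\<^sub>R f) = \<bar>r\<bar> * norm f" by transfer simp
  show "c *\<^sub>C (f + g) = c *\<^sub>C f + c *\<^sub>C g"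
    by transfer (auto intro!: blinfun_eqI simp: * blinfun.add_left scaleC_add_right)
  show "(c + d) *\<^sub>C f = c *\<^sub>C f + d *\<^sub>C f"
    by transfer (auto intro!: blinfun_eqI simp: * blinfun.add_left scaleC_add_left)
  show "c *\<^sub>C d *\<^sub>C f = (c * d) *\<^sub>C f"
    by transfer (auto intro!: blinfun_eqI simp: * scaleC_scaleC)
  show "complex_of_real r *\<^sub>C f = r *\<^sub>R f"
    by transfer (auto intro!: blinfun_eqI simp: * blinfun.scaleR_left scaleC_of_real)
  show "norm (c *\<^sub>C f) = cmod c * norm f"
  proof transfer
    fix c and f :: "'a \<Rightarrow>\<^sub>L 'b"
    have le: "norm (Blinfun (scaleC c) o\<^sub>L f) \<le> cmod c * norm f" for c and f :: "'a \<Rightarrow>\<^sub>L 'b"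
    proof (rule norm_blinfun_bound)
      show "norm ((Blinfun (scaleC c) o\<^sub>L f) x) \<le> cmod c * norm f * norm x" for x
        using mult_left_mono[OF norm_blinfun[of f x] norm_ge_zero[of c]]
        by (simp add: * norm_scaleC mult.assoc)
    qed simp
    show "norm (Blinfun (scaleC c) o\<^sub>L f) = cmod c * norm f"
    proof (cases "c = 0")
      case True
      then show ?thesis using le[of c f] by simp
    next
      case False
      have "f = Blinfun (scaleC (inverse c)) o\<^sub>L (Blinfun (scaleC c) o\<^sub>L f)"
        using False by (auto intro!: blinfun_eqI simp: * scaleC_scaleC)
      then have "norm f \<le> cmod (inverse c) * norm (Blinfun (scaleC c) o\<^sub>L f)"
        using le[of "inverse c" "Blinfun (scaleC c) o\<^sub>L f"] by simp
      then have "cmod c * norm f \<le> norm (Blinfun (scaleC c) o\<^sub>L f)"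
        using False by (simp add: norm_inverse norm_divide field_simps)
      then show ?thesis using le[of c f] by simp
    qed
  qed
qed

end

instance cblinfun :: (complex_normed_vector, complex_banach) complex_banach
proof
  fix F :: "nat \<Rightarrow> ('a, 'b) cblinfun"
  assume F: "Cauchy F"
  have d: "dist (Rep_cblinfun f) (Rep_cblinfun g) = dist f g" for f g :: "('a, 'b) cblinfun"
    by (simp add: dist_norm norm_cblinfun.rep_eq minus_cblinfun.rep_eq)
  have "Cauchy (\<lambda>n. Rep_cblinfun (F n))"
    using F by (simp add: Cauchy_def d)
  then obtain f where f: "(\<lambda>n. Rep_cblinfun (F n)) \<longlonglongrightarrow> f"
    using Cauchy_convergent convergent_def by blast
  have lim: "(\<lambda>n. Rep_cblinfun (F n) x) \<longlonglongrightarrow> f x" for x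
    by (intro tendsto_intros f)
  have "f (c *\<^sub>C x) = c *\<^sub>C f x" for c x
  proof (rule LIMSEQ_unique[OF lim])
    show "(\<lambda>n. Rep_cblinfun (F n) (c *\<^sub>C x)) \<longlonglongrightarrow> c *\<^sub>C f x"
      using bounded_linear.tendsto[OF bounded_linear_scaleC lim, of c x] Rep_cblinfun[of "F _"]
      by simp
  qed
  then have "Rep_cblinfun (Abs_cblinfun f) = f"
    by (simp add: Abs_cblinfun_inverse)
  then have "F \<longlonglongrightarrow> Abs_cblinfun f"
    using f by (simp add: tendsto_iff flip: d)
  then show "convergent F" by (auto simp: convergent_def)
qed

lift_definition cblinfun_apply ::
  "('a::complex_normed_vector, 'b::complex_normed_vector) cblinfun \<Rightarrow> 'a \<Rightarrow> 'b"
  is blinfun_apply .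

lift_definition cblinfun_compose ::
  "('b::complex_normed_vector, 'c::complex_normed_vector) cblinfun \<Rightarrow>
   ('a::complex_normed_vector, 'b) cblinfun \<Rightarrow> ('a, 'c) cblinfun"  (infixl "o\<^sub>C" 55)
  is blinfun_compose by simp

lemma cblinfun_apply_compose [simp]:
  "cblinfun_apply (S o\<^sub>C T) x = cblinfun_apply S (cblinfun_apply T x)"
  by transfer simp

lemma norm_cblinfun_onorm: "norm T = onorm (cblinfun_apply T)"
  by transfer (rule norm_blinfun.rep_eq)

lemma norm_cblinfun_apply: "norm (cblinfun_apply T x) \<le> norm T * norm x"
  by transfer (rule norm_blinfun)

type_synonym 'z cdual = "('z, complex) cblinfun"

definition weak_star_tendsto ::
  "(nat \<Rightarrow> ('a::complex_normed_vector, 'z::complex_normed_vector cdual) cblinfun) \<Rightarrow>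
   ('a, 'z cdual) cblinfun \<Rightarrow> bool"
  where "weak_star_tendsto S T \<longleftrightarrow>
    (\<forall>x z. (\<lambda>n. cmod (cblinfun_apply (cblinfun_apply (S n) x) z
                     - cblinfun_apply (cblinfun_apply T x) z)) \<longlonglongrightarrow> 0)"


section \<open>Codimension and Gelfand numbers\<close>

text \<open>The cosets \<open>b + M\<close> (\<open>b \<in> B\<close>) are pairwise distinct and form a basis of the quotient by \<open>M\<close>.\<close>

definition is_basis_mod :: "'a::complex_normed_vector set \<Rightarrow> 'a set \<Rightarrow> bool"
  where "is_basis_mod M B \<longleftrightarrow>
    cvec.independent B \<and> cvec.span B \<inter> M = {0} \<and> cvec.span (M \<union> B) = UNIV"

text \<open>The dimension of the quotient by \<open>M\<close>; it is \<open>\<infinity>\<close> if there is no finite basis,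
  and all finite bases have the same cardinality (lemma \<open>ccodim_eq\<close> below).\<close>

definition ccodim :: "'a::complex_normed_vector set \<Rightarrow> enat"
  where "ccodim M = (INF B\<in>{B. finite B \<and> is_basis_mod M B}. enat (card B))"

lemma basis_mod_card_le:
  assumes M: "cvec.subspace M" and B: "finite B" "is_basis_mod M B"
    and C: "finite C" "is_basis_mod M C"
  shows "card B \<le> card C"
proof -
  obtain u where u: "\<And>b. \<exists>m\<in>M. b = m + u b" "\<And>b. u b \<in> cvec.span C"
  proof -
    have "\<exists>v\<in>cvec.span C. \<exists>m\<in>M. b = m + v" for b
    proof -
      have "b \<in> cvec.span (M \<union> C)" using C(2) by (simp add: is_basis_mod_def)
      then show ?thesis using M by (auto simp: cvec.span_Un cvec.span_eq_iff[THEN iffD2])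
    qed
    then show thesis using that by metis
  qed
  have sub: "x - y \<in> M" if "x \<in> M" "y \<in> M" for x y
    using M that by (rule cvec.subspace_diff)
  have zero: "\<forall>b\<in>B. f b = 0" if "(\<Sum>b\<in>B. f b *\<^sub>C u b) = 0" for f
  proof -
    have "(\<Sum>b\<in>B. f b *\<^sub>C b) = (\<Sum>b\<in>B. f b *\<^sub>C (b - u b))"
      using that by (simp add: cvec.scale_right_diff_distrib sum_subtractf)
    also have "\<dots> \<in> M"
      by (intro cvec.subspace_sum[OF M] cvec.subspace_scale[OF M])
         (metis u(1) add_diff_cancel_right')
    finally have "(\<Sum>b\<in>B. f b *\<^sub>C b) \<in> cvec.span B \<inter> M"
      by (simp add: cvec.span_sum cvec.span_scale cvec.span_base)
    then have "(\<Sum>b\<in>B. f b *\<^sub>C b) = 0"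
      using B(2) by (auto simp: is_basis_mod_def)
    then show ?thesis
      using B by (auto simp: is_basis_mod_def cvec.dependent_finite)
  qed
  have inj: "inj_on u B"
  proof (rule inj_onI, rule ccontr)
    fix x y assume xy: "x \<in> B" "y \<in> B" "u x = u y" "x \<noteq> y"
    let ?f = "\<lambda>b. if b = x then 1 else if b = y then -1 else 0 :: complex"
    have "(\<Sum>b\<in>B. ?f b *\<^sub>C u b) = (\<Sum>b\<in>{x, y}. ?f b *\<^sub>C u b)"
      using xy B(1) by (intro sum.mono_neutral_right) auto
    also have "\<dots> = 0" using xy by simp
    finally show False using zero[of ?f] xy by fastforce
  qed
  have "cvec.independent (u ` B)"
  proof
    assume "cvec.dependent (u ` B)"
    then obtain f where f: "(\<Sum>v\<in>u ` B. f v *\<^sub>C v) = 0" "\<exists>v\<in>u ` B. f v \<noteq> 0"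
      using B(1) by (auto simp: cvec.dependent_finite)
    have "(\<Sum>b\<in>B. f (u b) *\<^sub>C u b) = 0" using f(1) inj by (simp add: sum.reindex)
    then show False using zero[of "\<lambda>b. f (u b)"] f(2) by auto
  qed
  then have "card (u ` B) \<le> card C"
    using cvec.independent_span_bound[OF C(1)] u(2) by blast
  then show ?thesis using card_image[OF inj] by simp
qed

lemma ccodim_eq:
  assumes "cvec.subspace M" "finite B" "is_basis_mod M B"
  shows "ccodim M = enat (card B)"
  unfolding ccodim_def
  by (rule antisym; (intro INF_lower INF_greatest)?)
     (use assms basis_mod_card_le in auto)

text \<open>The norm of \<open>T\<close> restricted to \<open>M\<close>; for \<open>M = UNIV\<close> this is \<open>onorm\<close>.
  The term at \<open>x = 0\<close> is \<open>0\<close>, as division by zero yields zero.\<close>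

definition norm_on ::
  "'a::complex_normed_vector set \<Rightarrow> ('a, 'b::complex_normed_vector) cblinfun \<Rightarrow> real"
  where "norm_on M T = (SUP x\<in>M. norm (cblinfun_apply T x) / norm x)"

lemma norm_on_UNIV: "norm_on UNIV T = norm T"
  by (simp add: norm_on_def norm_cblinfun_onorm onorm_def)

definition gelfand_number ::
  "nat \<Rightarrow> ('a::complex_normed_vector, 'b::complex_normed_vector) cblinfun \<Rightarrow> real"
  where "gelfand_number k T =
    (INF M\<in>{M. cvec.subspace M \<and> ccodim M < enat k}. norm_on M T)"

end

theory Submission
  imports Defs
begin

text \<open>
  A subspace \<open>M\<close> has codimension less than \<open>k\<close> iff every family of \<open>k\<close> vectors has a
  nontrivial linear combination in \<open>M\<close>. Preimages under \<open>P n\<close> inherit this property, which gives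
  \<open>c\<^sub>k (T P\<^sub>n) \<le> c\<^sub>k T\<close>. For the lower bound, suppose \<open>T P\<^sub>n\<close> is bounded by \<open>b < c\<^sub>k T\<close> on
  subspaces \<open>M\<^sub>n\<close> of codimension less than \<open>k\<close>, for infinitely many \<open>n\<close>, and fix an ultrafilter on
  these \<open>n\<close>. The limits of vectors \<open>y\<^sub>n \<in> M\<^sub>n\<close> form a subspace. Its codimension is less than
  \<open>k\<close>, because the coefficients of the linear combinations, normalised in the \<open>l\<^sup>1\<close> norm,
  converge along the ultrafilter. On it \<open>T\<close> is bounded by \<open>b\<close>, since the norm of the dual space is
  weak-star lower semicontinuous. This contradicts \<open>b < c\<^sub>k T\<close>.
\<close>

section \<open>Ultrafilters and their limits in compact sets\<close>

text \<open>Zorn's lemma is applied to the sets \<open>ev G\<close> for proper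
  \<open>G \<le> F\<close>; a maximal one belongs to a minimal proper filter \<open>U\<close>. If
  \<open>P\<close> is compatible with \<open>U\<close>, intersecting \<open>U\<close> with
  \<open>P\<close> cannot give a strictly finer filter, so \<open>P\<close> already holds
  eventually.\<close>

lemma ultrafilter_exists:
  fixes F :: "'a filter"
  assumes "F \<noteq> bot"
  obtains U where "U \<le> F" "U \<noteq> bot"
    "\<And>P. eventually P U \<or> eventually (\<lambda>x. \<not> P x) U"
proof -
  define ev :: "'a filter \<Rightarrow> ('a \<Rightarrow> bool) set" where "ev G = {P. eventually P G}" for G
  have ev_le: "ev G \<subseteq> ev H \<longleftrightarrow> H \<le> G" for G H
    by (auto simp: ev_def le_filter_def)
  define \<G> where "\<G> = {G. G \<noteq> bot \<and> G \<le> F}"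
  have "\<exists>m\<in>ev ` \<G>. \<forall>X\<in>ev ` \<G>. m \<subseteq> X \<longrightarrow> X = m"
  proof (rule subset_Zorn_nonempty)
    show "ev ` \<G> \<noteq> {}" using assms by (auto simp: \<G>_def)
  next
    fix \<C> assume \<C>: "\<C> \<noteq> {}" "subset.chain (ev ` \<G>) \<C>"
    define \<H> where "\<H> = {G\<in>\<G>. ev G \<in> \<C>}"
    have im: "\<C> = ev ` \<H>"
      using \<C>(2) by (auto simp: \<H>_def subset.chain_def)
    with \<C>(1) have ne: "\<H> \<noteq> {}" by auto
    \<comment> \<open>A chain is directed, so a property holds eventually for the infimum iff it
      does so for some member. In particular \<open>False\<close> does not, and the infimum stays
      proper.\<close>
    have "eventually P (Inf \<H>) \<longleftrightarrow> (\<exists>G\<in>\<H>. eventually P G)" for P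
    proof (rule eventually_Inf_base[OF ne])
      fix G H assume GH: "G \<in> \<H>" "H \<in> \<H>"
      then have "ev G \<subseteq> ev H \<or> ev H \<subseteq> ev G"
        using \<C>(2) by (auto simp: \<H>_def subset_chain_def)
      with GH show "\<exists>K\<in>\<H>. K \<le> inf G H"
        unfolding ev_le by (auto intro: bexI[of _ G] bexI[of _ H])
    qed
    then have Un: "\<Union>\<C> = ev (Inf \<H>)" "Inf \<H> \<noteq> bot"
      unfolding im by (auto simp: ev_def trivial_limit_def \<H>_def \<G>_def)
    moreover from ne obtain G where "G \<in> \<H>" by blast
    then have "Inf \<H> \<le> F" by (auto simp: \<H>_def \<G>_def intro: Inf_lower2)
    ultimately show "\<Union>\<C> \<in> ev ` \<G>" by (auto simp: \<G>_def)
  qed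
  then obtain U where U: "U \<in> \<G>" "\<And>G. G \<in> \<G> \<Longrightarrow> G \<le> U \<Longrightarrow> U \<le> G"
    unfolding ball_simps bex_simps by (metis ev_le order_refl)
  show thesis
  proof
    show "U \<le> F" "U \<noteq> bot" using U(1) by (auto simp: \<G>_def)
    show "eventually P U \<or> eventually (\<lambda>x. \<not> P x) U" for P
    proof (cases "inf U (principal {x. P x}) = bot")
      case True
      then show ?thesis
        by (auto simp: trivial_limit_def eventually_inf_principal elim: eventually_mono)
    next
      case False
      then have "inf U (principal {x. P x}) \<in> \<G>"
        using U(1) by (auto simp: \<G>_def intro: le_infI1)
      then have "U \<le> principal {x. P x}"
        using U(2)[of "inf U (principal {x. P x})"] by simp
      then show ?thesis by (simp add: le_principal)
    qed
  qed
qed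

text \<open>Compactness supplies a cluster point of the image filter. As \<open>U\<close> decides
  \<open>f x \<in> S\<close> for every open \<open>S\<close> around it, the cluster point is a
  limit.\<close>

lemma ultrafilter_tendsto_compact:
  assumes U: "U \<noteq> bot" "\<And>P. eventually P U \<or> eventually (\<lambda>x. \<not> P x) U"
    and C: "compact C" "eventually (\<lambda>x. f x \<in> C) U"
  obtains l where "(f \<longlongrightarrow> l) U"
proof -
  have "filtermap f U \<noteq> bot" using U(1) by (simp add: filtermap_bot_iff)
  then obtain l where l: "inf (nhds l) (filtermap f U) \<noteq> bot"
    using C(1)[unfolded compact_filter, rule_format, of "filtermap f U"] C(2)
    by (auto simp: eventually_filtermap)
  have "(f \<longlongrightarrow> l) U"
  proof (rule topological_tendstoI, rule ccontr)
    fix S assume S: "open S" "l \<in> S" "\<not> (\<forall>\<^sub>F x in U. f x \<in> S)"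
    then have "\<forall>\<^sub>F y in filtermap f U. y \<notin> S"
      using U(2)[of "\<lambda>x. f x \<in> S"] by (simp add: eventually_filtermap)
    moreover have "\<forall>\<^sub>F y in nhds l. y \<in> S" using S by (simp add: eventually_nhds_in_open)
    ultimately have "\<forall>\<^sub>F y in inf (nhds l) (filtermap f U). False"
      unfolding eventually_inf by blast
    with l show False by (simp add: trivial_limit_def)
  qed
  with that show thesis .
qed

section \<open>Elementary facts on bounded complex-linear maps\<close>

lemma cblinfun_apply_scaleC: "cblinfun_apply T (c *\<^sub>C x) = c *\<^sub>C cblinfun_apply T x"
  by transfer simp

lemma bounded_linear_cblinfun_apply: "bounded_linear (cblinfun_apply T)"
  by transfer (rule blinfun.bounded_linear_right)

lemmas cblinfun_apply_add = linear_add[OF bounded_linear.linear[OF bounded_linear_cblinfun_apply]]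
  and cblinfun_apply_sum = linear_sum[OF bounded_linear.linear[OF bounded_linear_cblinfun_apply]]
  and cblinfun_apply_zero = linear_0[OF bounded_linear.linear[OF bounded_linear_cblinfun_apply]]

lemma norm_cblinfun_le:
  assumes "0 \<le> b" "\<And>x. norm (cblinfun_apply T x) \<le> b * norm x"
  shows "norm T \<le> b"
  using assms by transfer (rule norm_blinfun_bound)

lemma norm_cblinfun_compose_le: "norm (S o\<^sub>C T) \<le> norm S * norm T"
  by transfer (rule norm_blinfun_compose)

section \<open>Codimension through linear dependence modulo a subspace\<close>

text \<open>A repeated vector gives the coefficients \<open>1\<close> and \<open>-1\<close>;
  otherwise there are \<open>k\<close> distinct vectors in a span of fewer than
  \<open>k\<close>.\<close>

lemma family_dependent:
  fixes u :: "nat \<Rightarrow> 'a::complex_normed_vector"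
  assumes B: "finite B" "card B < k" and u: "\<And>i. u i \<in> cvec.span B"
  shows "\<exists>c. (\<exists>i<k. c i \<noteq> 0) \<and> (\<Sum>i<k. c i *\<^sub>C u i) = 0"
proof (cases "inj_on u {..<k}")
  case True
  have "cvec.dependent (u ` {..<k})"
    using cvec.independent_span_bound[OF B(1), of "u ` {..<k}"] u B(2) True
    by (force simp: card_image)
  then obtain f where f: "(\<Sum>v\<in>u ` {..<k}. f v *\<^sub>C v) = 0" "\<exists>v\<in>u ` {..<k}. f v \<noteq> 0"
    by (auto simp: cvec.dependent_finite)
  then show ?thesis
    using True by (intro exI[of _ "f \<circ> u"]) (auto simp: sum.reindex)
next
  case False
  then obtain a b where ab: "a < k" "b < k" "a \<noteq> b" "u a = u b"
    by (auto simp: inj_on_def)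
  define c :: "nat \<Rightarrow> complex" where "c i = (if i = a then 1 else if i = b then -1 else 0)" for i
  have "(\<Sum>i<k. c i *\<^sub>C u i) = (\<Sum>i\<in>{a, b}. c i *\<^sub>C u i)"
    using ab by (intro sum.mono_neutral_right) (auto simp: c_def)
  also have "\<dots> = 0" using ab by (simp add: c_def)
  finally show ?thesis using ab(1) by (auto intro!: exI[of _ c] simp: c_def)
qed

text \<open>Modulo \<open>M\<close>, the vectors lie in the span of fewer than \<open>k\<close>
  basis elements. Conversely, \<open>k\<close> basis elements of a complement have no nontrivial
  combination in \<open>M\<close>. The criterion mentions no basis, which is why it transfers to
  preimages and limits.\<close>

lemma ccodim_less_iff:
  fixes M :: "'a::complex_normed_vector set"
  assumes M: "cvec.subspace M"
  shows "ccodim M < enat k \<longleftrightarrow>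
    (\<forall>x :: nat \<Rightarrow> 'a. \<exists>c. (\<exists>i<k. c i \<noteq> 0) \<and> (\<Sum>i<k. c i *\<^sub>C x i) \<in> M)"
proof
  assume "ccodim M < enat k"
  then obtain B where B: "finite B" "is_basis_mod M B" "card B < k"
    by (auto simp: ccodim_def INF_less_iff)
  show "\<forall>x :: nat \<Rightarrow> 'a. \<exists>c. (\<exists>i<k. c i \<noteq> 0) \<and> (\<Sum>i<k. c i *\<^sub>C x i) \<in> M"
  proof
    fix x :: "nat \<Rightarrow> 'a"
    have "\<exists>m\<in>M. \<exists>v\<in>cvec.span B. x i = m + v" for i
    proof -
      have "x i \<in> cvec.span (M \<union> B)" using B(2) by (simp add: is_basis_mod_def)
      then show ?thesis using M by (auto simp: cvec.span_Un cvec.span_eq_iff[THEN iffD2])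
    qed
    then obtain m u where mu: "\<And>i. m i \<in> M" "\<And>i. u i \<in> cvec.span B" "\<And>i. x i = m i + u i"
      by metis
    obtain c where c: "\<exists>i<k. c i \<noteq> 0" "(\<Sum>i<k. c i *\<^sub>C u i) = 0"
      using family_dependent[of B k u, OF B(1,3) mu(2)] by (auto intro: that)
    have "(\<Sum>i<k. c i *\<^sub>C x i) = (\<Sum>i<k. c i *\<^sub>C m i)"
      using c(2) by (simp add: mu(3) scaleC_add_right sum.distrib)
    also have "\<dots> \<in> M"
      by (intro cvec.subspace_sum[OF M] cvec.subspace_scale[OF M] mu(1))
    finally show "\<exists>c. (\<exists>i<k. c i \<noteq> 0) \<and> (\<Sum>i<k. c i *\<^sub>C x i) \<in> M"
      using c(1) by (intro exI[of _ c] conjI)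
  qed
next
  assume dep: "\<forall>x :: nat \<Rightarrow> 'a. \<exists>c. (\<exists>i<k. c i \<noteq> 0) \<and> (\<Sum>i<k. c i *\<^sub>C x i) \<in> M"
  \<comment> \<open>A basis \<open>A\<close> of \<open>M\<close> is extended to a basis
    \<open>C\<close> of the whole space; the added vectors \<open>B\<close> span a
    complement.\<close>
  obtain A where A: "A \<subseteq> M" "cvec.independent A" "M \<subseteq> cvec.span A"
    by (rule cvec.maximal_independent_subset)
  define C where "C = cvec.extend_basis A"
  have C: "A \<subseteq> C" "cvec.independent C" "cvec.span C = UNIV"
    unfolding C_def using A(2)
    by (auto simp: cvec.extend_basis_superset cvec.independent_extend_basis)
  define B where "B = C - A"
  have AB: "A \<union> B = C" using C(1) by (auto simp: B_def)
  have B: "is_basis_mod M B"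
    unfolding is_basis_mod_def
  proof (intro conjI)
    show "cvec.independent B" unfolding B_def by (rule cvec.independent_mono[OF C(2)]) auto
    show "cvec.span B \<inter> M = {0}"
    proof (intro equalityI subsetI)
      fix v assume "v \<in> cvec.span B \<inter> M"
      then have v: "v \<in> cvec.span B" "v \<in> cvec.span A" using A(3) by auto
      \<comment> \<open>The coordinates of \<open>v\<close> with respect to \<open>C\<close> are
        supported both in \<open>A\<close> and in the disjoint set \<open>B\<close>.\<close>
      have eq: "cvec.representation C v = cvec.representation B v"
        "cvec.representation C v = cvec.representation A v"
        using v C(1,2) by (auto intro!: cvec.representation_extend simp: B_def)
      have "{b. cvec.representation C v b \<noteq> 0} = {}"
      proof (rule ccontr)
        assume "{b. cvec.representation C v b \<noteq> 0} \<noteq> {}"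
        then obtain b where b: "cvec.representation C v b \<noteq> 0" by blast
        then have "b \<in> B" "b \<in> A"
          using eq cvec.representation_ne_zero by metis+
        then show False by (simp add: B_def)
      qed
      moreover have "(\<Sum>b | cvec.representation C v b \<noteq> 0. cvec.representation C v b *\<^sub>C b) = v"
        using C by (intro cvec.sum_nonzero_representation_eq) auto
      ultimately show "v \<in> {0}" by simp
    qed (use M cvec.subspace_0 cvec.span_zero in auto)
    show "cvec.span (M \<union> B) = UNIV"
      using cvec.span_mono[of C "M \<union> B"] A(1) C(3) AB by auto
  qed
  have "finite B \<and> card B < k"
  proof (rule ccontr)
    assume "\<not> (finite B \<and> card B < k)"
    then obtain S where S: "S \<subseteq> B" "card S = k" "finite S"
      by (metis infinite_arbitrarily_large not_le obtain_subset_with_card_n)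
    then obtain x where x: "bij_betw x {..<k} S"
      by (metis atLeast0LessThan ex_bij_betw_nat_finite)
    obtain c where c: "\<exists>i<k. c i \<noteq> 0" "(\<Sum>i<k. c i *\<^sub>C x i) \<in> M"
      using dep[rule_format, of x] by (auto intro: that)
    have "(\<Sum>i<k. c i *\<^sub>C x i) \<in> cvec.span B"
      using x S(1) by (intro cvec.span_sum cvec.span_scale cvec.span_base) (auto simp: bij_betw_def)
    with c(2) B have "(\<Sum>i<k. c i *\<^sub>C x i) = 0" by (auto simp: is_basis_mod_def)
    \<comment> \<open>Independence speaks of sets, so the coefficients are carried from the indices
      to the elements of \<open>S\<close>.\<close>
    moreover have inv: "the_inv_into {..<k} x (x i) = i" if "i < k" for i
      using x that by (auto simp: bij_betw_def the_inv_into_f_f)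
    have "(\<Sum>i<k. c i *\<^sub>C x i) = (\<Sum>s\<in>S. c (the_inv_into {..<k} x s) *\<^sub>C s)"
      by (subst sum.reindex_bij_betw[OF x, symmetric]) (simp add: inv)
    ultimately have sum_0: "(\<Sum>s\<in>S. c (the_inv_into {..<k} x s) *\<^sub>C s) = 0" by simp
    have "cvec.independent S"
      using cvec.independent_mono[OF _ S(1)] B by (simp add: is_basis_mod_def)
    then have "c i = 0" if "i < k" for i
      using cvec.independentD[OF _ S(3) subset_refl sum_0, of "x i"] inv[OF that] x that
      by (auto simp: bij_betw_def)
    with c(1) show False by blast
  qed
  then show "ccodim M < enat k"
    using ccodim_eq[OF M _ B] by simp
qed

section \<open>Restricted norms and bounds for Gelfand numbers\<close>

lemma bdd_above_norm_quotients:
  "bdd_above ((\<lambda>x. norm (cblinfun_apply T x) / norm x) ` M)"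
proof (rule bdd_aboveI2)
  show "norm (cblinfun_apply T x) / norm x \<le> norm T" for x
    using norm_cblinfun_apply[of T x] by (cases "x = 0") (simp_all add: field_simps)
qed

lemma norm_on_ge:
  assumes "x \<in> M"
  shows "norm (cblinfun_apply T x) \<le> norm_on M T * norm x"
proof (cases "x = 0")
  case False
  have "norm (cblinfun_apply T x) / norm x \<le> norm_on M T"
    unfolding norm_on_def using bdd_above_norm_quotients by (rule cSUP_upper[OF assms])
  then show ?thesis using False by (simp add: field_simps)
qed (simp add: cblinfun_apply_zero)

lemma norm_on_le:
  assumes "M \<noteq> {}" "0 \<le> b" "\<And>x. x \<in> M \<Longrightarrow> norm (cblinfun_apply T x) \<le> b * norm x"
  shows "norm_on M T \<le> b"
  unfolding norm_on_def
proof (rule cSUP_least[OF assms(1)])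
  show "norm (cblinfun_apply T x) / norm x \<le> b" if "x \<in> M" for x
    using assms(2) assms(3)[OF that] by (cases "x = 0") (simp_all add: field_simps)
qed

text \<open>The quotient at \<open>0\<close> is \<open>0\<close> by the convention for division by
  zero, and the supremum dominates it.\<close>

lemma norm_on_nonneg:
  assumes "0 \<in> M"
  shows "0 \<le> norm_on M T"
  unfolding norm_on_def using cSUP_upper[OF assms bdd_above_norm_quotients[of T M]] by simp

lemma gelfand_number_le:
  assumes "cvec.subspace M" "ccodim M < enat k"
  shows "gelfand_number k T \<le> norm_on M T"
  unfolding gelfand_number_def
  by (rule cINF_lower) (use assms in \<open>auto intro!: bdd_belowI2[where m = 0] norm_on_nonneg intro: cvec.subspace_0\<close>)

text \<open>Makes the infimum in \<open>gelfand_number\<close> range over a nonempty set; for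
  \<open>k = 0\<close> no subspace would qualify.\<close>

lemma ccodim_UNIV_less:
  assumes "k \<ge> 1"
  shows "ccodim UNIV < enat k"
  using assms by (subst ccodim_less_iff) (auto intro!: exI[of _ "\<lambda>_. 1"] exI[of _ 0])

lemma gelfand_number_greatest:
  assumes "k \<ge> 1"
    and "\<And>M. cvec.subspace M \<Longrightarrow> ccodim M < enat k \<Longrightarrow> b \<le> norm_on M T"
  shows "b \<le> gelfand_number k T"
  unfolding gelfand_number_def
  by (rule cINF_greatest) (use assms ccodim_UNIV_less in \<open>auto intro: cvec.subspace_UNIV\<close>)

text \<open>Upper half of the convergence: a subspace \<open>M\<close> admissible for
  \<open>T\<close> is replaced by its preimage under the contraction \<open>P\<close>, on which
  \<open>T o\<^sub>C P\<close> has no larger norm.\<close>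

lemma gelfand_number_compose_le:
  fixes P :: "('a::complex_normed_vector, 'b::complex_normed_vector) cblinfun"
  assumes P: "norm P \<le> 1" and k: "k \<ge> 1"
  shows "gelfand_number k (T o\<^sub>C P) \<le> gelfand_number k T"
proof (rule gelfand_number_greatest[OF k])
  fix M :: "'b set" assume M: "cvec.subspace M" "ccodim M < enat k"
  define N where "N = cblinfun_apply P -` M"
  have N: "cvec.subspace N"
    using M(1) unfolding N_def
    by (intro cvec.subspaceI)
      (simp_all add: cblinfun_apply_zero cblinfun_apply_add cblinfun_apply_scaleC
        cvec.subspace_0 cvec.subspace_add cvec.subspace_scale)
  \<comment> \<open>A combination of the images of the \<open>x i\<close> that lies in
    \<open>M\<close> is the image of the combination of the \<open>x i\<close> with the same
    coefficients.\<close>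
  have "\<exists>c. (\<exists>i<k. c i \<noteq> 0) \<and> (\<Sum>i<k. c i *\<^sub>C x i) \<in> N" for x :: "nat \<Rightarrow> 'a"
    using M(2)[unfolded ccodim_less_iff[OF M(1)], rule_format, of "cblinfun_apply P \<circ> x"]
    by (simp add: N_def cblinfun_apply_sum cblinfun_apply_scaleC)
  then have "gelfand_number k (T o\<^sub>C P) \<le> norm_on N (T o\<^sub>C P)"
    by (intro gelfand_number_le N) (simp add: ccodim_less_iff[OF N])
  also have "\<dots> \<le> norm_on M T"
  proof (rule norm_on_le)
    show "N \<noteq> {}" using cvec.subspace_0[OF N] by blast
    show nonneg: "0 \<le> norm_on M T" by (rule norm_on_nonneg[OF cvec.subspace_0[OF M(1)]])
    fix x assume "x \<in> N"
    then have "norm (cblinfun_apply T (cblinfun_apply P x)) \<le> norm_on M T * norm (cblinfun_apply P x)"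
      by (simp add: N_def norm_on_ge)
    also have "norm (cblinfun_apply P x) \<le> norm x"
      using norm_cblinfun_apply[of P x] mult_right_mono[OF P norm_ge_zero[of x]] by simp
    finally show "norm (cblinfun_apply (T o\<^sub>C P) x) \<le> norm_on M T * norm x"
      using nonneg by (simp add: mult_left_mono)
  qed
  finally show "gelfand_number k (T o\<^sub>C P) \<le> norm_on M T" .
qed

section \<open>Limits of subspaces along a filter\<close>

text \<open>For \<open>sequentially\<close> in a metric space this is the Kuratowski lower limit of
  the sets \<open>M i\<close>.\<close>

definition limit_set :: "'i filter \<Rightarrow> ('i \<Rightarrow> 'a::topological_space set) \<Rightarrow> 'a set" where
  "limit_set U M = {x. \<exists>y. (\<forall>\<^sub>F i in U. y i \<in> M i) \<and> (y \<longlongrightarrow> x) U}"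

lemma subspace_limit_set:
  fixes M :: "'i \<Rightarrow> 'a::complex_normed_vector set"
  assumes M: "\<forall>\<^sub>F i in U. cvec.subspace (M i)"
  shows "cvec.subspace (limit_set U M)"
proof (rule cvec.subspaceI)
  have "\<forall>\<^sub>F i in U. 0 \<in> M i" using M by eventually_elim (rule cvec.subspace_0)
  then show "0 \<in> limit_set U M" by (auto simp: limit_set_def intro!: exI[of _ "\<lambda>_. 0"])
next
  fix x y assume "x \<in> limit_set U M" "y \<in> limit_set U M"
  then obtain f g where f: "\<forall>\<^sub>F i in U. f i \<in> M i" "(f \<longlongrightarrow> x) U"
    and g: "\<forall>\<^sub>F i in U. g i \<in> M i" "(g \<longlongrightarrow> y) U" by (auto simp: limit_set_def)
  have "\<forall>\<^sub>F i in U. f i + g i \<in> M i"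
    using M f(1) g(1) by eventually_elim (rule cvec.subspace_add)
  then show "x + y \<in> limit_set U M"
    using tendsto_add[OF f(2) g(2)] by (auto simp: limit_set_def)
next
  fix c x assume "x \<in> limit_set U M"
  then obtain f where f: "\<forall>\<^sub>F i in U. f i \<in> M i" "(f \<longlongrightarrow> x) U" by (auto simp: limit_set_def)
  have "\<forall>\<^sub>F i in U. c *\<^sub>C f i \<in> M i"
    using M f(1) by eventually_elim (rule cvec.subspace_scale)
  then show "c *\<^sub>C x \<in> limit_set U M"
    using bounded_linear.tendsto[OF bounded_linear_scaleC f(2)] by (auto simp: limit_set_def)
qed

lemma tendsto_scaleC_left:
  fixes x :: "'a::complex_normed_vector"
  assumes "(c \<longlongrightarrow> l) F"
  shows "((\<lambda>i. c i *\<^sub>C x) \<longlongrightarrow> l *\<^sub>C x) F"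
proof -
  have "bounded_linear (\<lambda>c. c *\<^sub>C x)"
    by (rule bounded_linear_intro[where K = "norm x"])
      (simp_all add: scaleC_add_left norm_scaleC scaleR_conv_of_real scaleC_scaleC flip: scaleC_of_real)
  then show ?thesis using assms by (rule bounded_linear.tendsto)
qed

lemma ccodim_limit_set:
  fixes M :: "'i \<Rightarrow> 'a::complex_normed_vector set"
  assumes U: "U \<noteq> bot" "\<And>P. eventually P U \<or> eventually (\<lambda>x. \<not> P x) U"
    and M: "\<forall>\<^sub>F i in U. cvec.subspace (M i) \<and> ccodim (M i) < enat k"
  shows "ccodim (limit_set U M) < enat k"
proof -
  have "\<forall>\<^sub>F i in U. cvec.subspace (M i)" using M by eventually_elim simp
  note sub = subspace_limit_set[OF this]
  have "\<exists>c. (\<exists>j<k. c j \<noteq> 0) \<and> (\<Sum>j<k. c j *\<^sub>C x j) \<in> limit_set U M" for x :: "nat \<Rightarrow> 'a"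
  proof -
    \<comment> \<open>Total modulus \<open>1\<close> keeps the coefficients in the compact unit disc
      and prevents them from all tending to zero.\<close>
    have "\<forall>\<^sub>F i in U. \<exists>c. (\<Sum>j<k. cmod (c j)) = 1 \<and> (\<Sum>j<k. c j *\<^sub>C x j) \<in> M i"
      using M
    proof eventually_elim
      fix i assume "cvec.subspace (M i) \<and> ccodim (M i) < enat k"
      then have Mi: "cvec.subspace (M i)" "ccodim (M i) < enat k" by auto
      obtain c where c: "\<exists>j<k. c j \<noteq> 0" "(\<Sum>j<k. c j *\<^sub>C x j) \<in> M i"
        using Mi(2)[unfolded ccodim_less_iff[OF Mi(1)], rule_format, of x]
        by (auto intro: that)
      define s where "s = (\<Sum>j<k. cmod (c j))"
      have "s > 0" unfolding s_def using c(1) by (auto intro!: sum_pos2)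
      have "(\<Sum>j<k. cmod (c j / of_real s)) = 1"
        using \<open>s > 0\<close> by (simp add: norm_divide flip: sum_divide_distrib s_def)
      moreover have "(\<Sum>j<k. (c j / of_real s) *\<^sub>C x j) = inverse (of_real s) *\<^sub>C (\<Sum>j<k. c j *\<^sub>C x j)"
        by (simp add: cvec.scale_sum_right divide_inverse mult.commute)
      then have "(\<Sum>j<k. (c j / of_real s) *\<^sub>C x j) \<in> M i"
        using cvec.subspace_scale[OF Mi(1) c(2)] by simp
      ultimately show "\<exists>c. (\<Sum>j<k. cmod (c j)) = 1 \<and> (\<Sum>j<k. c j *\<^sub>C x j) \<in> M i"
        by (intro exI[of _ "\<lambda>j. c j / of_real s"] conjI)
    qed
    then obtain c where c: "\<forall>\<^sub>F i in U. (\<Sum>j<k. cmod (c i j)) = 1 \<and> (\<Sum>j<k. c i j *\<^sub>C x j) \<in> M i"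
      unfolding eventually_ex by (elim exE)
    have "\<exists>l. ((\<lambda>i. c i j) \<longlongrightarrow> l) U" if "j < k" for j
    proof -
      have "\<forall>\<^sub>F i in U. c i j \<in> cball 0 1"
        using c
      proof eventually_elim
        case (elim i)
        have "cmod (c i j) \<le> (\<Sum>j<k. cmod (c i j))"
          using that by (intro member_le_sum) auto
        then show ?case using elim by simp
      qed
      then show ?thesis
        using ultrafilter_tendsto_compact[OF U compact_cball] by metis
    qed
    then obtain l where l: "\<And>j. j < k \<Longrightarrow> ((\<lambda>i. c i j) \<longlongrightarrow> l j) U" by metis
    have "((\<lambda>i. \<Sum>j<k. cmod (c i j)) \<longlongrightarrow> (\<Sum>j<k. cmod (l j))) U"
      by (intro tendsto_intros l) auto
    moreover have "((\<lambda>i. \<Sum>j<k. cmod (c i j)) \<longlongrightarrow> 1) U"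
      using c by (intro tendsto_eventually) (auto elim: eventually_mono)
    ultimately have "(\<Sum>j<k. cmod (l j)) = 1"
      using U(1) tendsto_unique by blast
    then have "\<exists>j<k. l j \<noteq> 0" by (metis (no_types, lifting) lessThan_iff norm_zero sum.neutral zero_neq_one)
    \<comment> \<open>The vectors \<open>x j\<close> are fixed, so convergence of the coefficients
      suffices; the combinations lying in \<open>M i\<close> are the approximants that
      \<open>limit_set\<close> asks for.\<close>
    moreover have "((\<lambda>i. \<Sum>j<k. c i j *\<^sub>C x j) \<longlongrightarrow> (\<Sum>j<k. l j *\<^sub>C x j)) U"
      by (intro tendsto_sum tendsto_scaleC_left l) auto
    then have "(\<Sum>j<k. l j *\<^sub>C x j) \<in> limit_set U M"
      using c by (auto simp: limit_set_def elim!: eventually_mono intro!: exI[of _ "\<lambda>i. \<Sum>j<k. c i j *\<^sub>C x j"])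
    ultimately show ?thesis by (intro exI[of _ l] conjI)
  qed
  then show ?thesis by (simp add: ccodim_less_iff[OF sub])
qed

section \<open>Weak-star lower semicontinuity\<close>

text \<open>Split \<open>x\<close> into \<open>y n\<close> and \<open>x - y n\<close>:
  \<open>S n\<close> is controlled by \<open>b\<close> on the first and by the uniform bound
  \<open>C\<close> on the second, which tends to zero. The estimate is tested on each
  \<open>z\<close>, where the weak-star limit can be taken.\<close>

lemma weak_star_limit_bound:
  fixes T :: "('x::complex_normed_vector, 'z::complex_normed_vector cdual) cblinfun"
  assumes U: "U \<noteq> bot" "U \<le> sequentially"
    and S: "weak_star_tendsto S T" "\<forall>\<^sub>F n in U. norm (S n) \<le> C"
    and b: "0 \<le> b" "\<forall>\<^sub>F n in U. \<forall>y\<in>M n. norm (cblinfun_apply (S n) y) \<le> b * norm y"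
    and x: "x \<in> limit_set U M"
  shows "norm (cblinfun_apply T x) \<le> b * norm x"
proof (rule norm_cblinfun_le)
  show "0 \<le> b * norm x" using b(1) by simp
  fix z :: 'z
  from x obtain y where y: "\<forall>\<^sub>F n in U. y n \<in> M n" "(y \<longlongrightarrow> x) U" by (auto simp: limit_set_def)
  \<comment> \<open>The term \<open>C * norm (x - x)\<close> is the vanishing limit of the error,
    kept in the shape that \<open>tendsto_intros\<close> yields and simplified away at the
    end.\<close>
  have "((\<lambda>n. (b * norm (y n) + C * norm (x - y n)) * norm z) \<longlongrightarrow> (b * norm x + C * norm (x - x)) * norm z) U"
    by (intro tendsto_intros y(2))
  moreover have "((\<lambda>n. cblinfun_apply (cblinfun_apply (S n) x) z) \<longlongrightarrow> cblinfun_apply (cblinfun_apply T x) z) sequentially"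
    using S(1) by (subst Lim_null, subst tendsto_norm_zero_iff[symmetric]) (simp add: weak_star_tendsto_def)
  then have "((\<lambda>n. norm (cblinfun_apply (cblinfun_apply (S n) x) z)) \<longlongrightarrow> norm (cblinfun_apply (cblinfun_apply T x) z)) U"
    by (intro tendsto_norm tendsto_mono[OF U(2)])
  moreover have "\<forall>\<^sub>F n in U. norm (cblinfun_apply (cblinfun_apply (S n) x) z)
      \<le> (b * norm (y n) + C * norm (x - y n)) * norm z"
    using S(2) b(2) y(1)
  proof eventually_elim
    case (elim n)
    have "norm (cblinfun_apply (S n) x) \<le> norm (cblinfun_apply (S n) (y n)) + norm (cblinfun_apply (S n) (x - y n))"
      using norm_triangle_ineq[of "cblinfun_apply (S n) (y n)" "cblinfun_apply (S n) (x - y n)"]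
      by (simp flip: cblinfun_apply_add)
    also have "norm (cblinfun_apply (S n) (x - y n)) \<le> C * norm (x - y n)"
      using norm_cblinfun_apply[of "S n" "x - y n"] mult_right_mono[OF elim(1) norm_ge_zero[of "x - y n"]] by simp
    also have "norm (cblinfun_apply (S n) (y n)) \<le> b * norm (y n)" using elim by blast
    finally show ?case
      using norm_cblinfun_apply[of "cblinfun_apply (S n) x" z] mult_right_mono[OF _ norm_ge_zero[of z]]
      by fastforce
  qed
  ultimately have "norm (cblinfun_apply (cblinfun_apply T x) z) \<le> (b * norm x + C * norm (x - x)) * norm z"
    using U(1) tendsto_le by blast
  then show "norm (cblinfun_apply (cblinfun_apply T x) z) \<le> b * norm x * norm z" by simp
qed

lemma gelfand_number_weak_star_lsc:
  fixes T :: "('x::complex_normed_vector, 'z::complex_normed_vector cdual) cblinfun"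
  assumes S: "weak_star_tendsto S T" "\<forall>\<^sub>F n in sequentially. norm (S n) \<le> C"
    and k: "k \<ge> 1" and a: "a < gelfand_number k T"
  shows "\<forall>\<^sub>F n in sequentially. a < gelfand_number k (S n)"
proof (rule ccontr)
  assume neg: "\<not> ?thesis"
  \<comment> \<open>\<open>F\<close> is proper because the claim fails: infinitely many indices have
    a Gelfand number at most \<open>a\<close>.\<close>
  define F where "F = inf sequentially (principal {n. gelfand_number k (S n) \<le> a})"
  have "F \<noteq> bot"
    using neg by (simp add: F_def trivial_limit_def eventually_inf_principal not_le)
  then obtain U where U: "U \<le> F" "U \<noteq> bot" "\<And>P. eventually P U \<or> eventually (\<lambda>x. \<not> P x) U"
    using ultrafilter_exists by metis
  have U_seq: "U \<le> sequentially" using U(1) by (simp add: F_def)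
  have U_le: "\<forall>\<^sub>F n in U. gelfand_number k (S n) \<le> a"
    using U(1) by (simp add: F_def le_principal)
  \<comment> \<open>The infimum need not be attained, so there must be room above \<open>a\<close>:
    a Gelfand number at most \<open>a\<close> yields a subspace with restricted norm at most
    \<open>b\<close>.\<close>
  obtain b where b: "a < b" "b < gelfand_number k T" using a dense by blast
  have "\<forall>\<^sub>F n in U. \<exists>M. cvec.subspace M \<and> ccodim M < enat k \<and> norm_on M (S n) \<le> b"
    using U_le
  proof eventually_elim
    case (elim n)
    then show ?case
      using gelfand_number_greatest[OF k, of b "S n"] b(1) by (meson linear not_le order_trans)
  qed
  then obtain M where M: "\<forall>\<^sub>F n in U. cvec.subspace (M n) \<and> ccodim (M n) < enat k \<and> norm_on (M n) (S n) \<le> b"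
    unfolding eventually_ex by blast
  have sub: "cvec.subspace (limit_set U M)"
    using M by (intro subspace_limit_set) (auto elim: eventually_mono)
  have codim: "ccodim (limit_set U M) < enat k"
    using M by (intro ccodim_limit_set U) (auto elim: eventually_mono)
  \<comment> \<open>Restricted norms are nonnegative; as \<open>U\<close> is proper, a statement
    free of \<open>n\<close> that holds eventually is true.\<close>
  have "\<forall>\<^sub>F n in U. 0 \<le> b"
    using M by eventually_elim (meson cvec.subspace_0 norm_on_nonneg order_trans)
  then have b0: "0 \<le> b" using U(2) by simp
  have bound: "\<forall>\<^sub>F n in U. \<forall>y\<in>M n. norm (cblinfun_apply (S n) y) \<le> b * norm y"
    using M by eventually_elim (meson mult_right_mono norm_ge_zero norm_on_ge order_trans)
  have "gelfand_number k T \<le> norm_on (limit_set U M) T" by (rule gelfand_number_le[OF sub codim])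
  also have "\<dots> \<le> b"
    using weak_star_limit_bound[OF U(2) U_seq S(1) filter_leD[OF U_seq S(2)] b0 bound]
      cvec.subspace_0[OF sub] b0 by (intro norm_on_le) auto
  finally show False using b(2) by simp
qed

theorem theorem12:
  fixes T :: "('x::complex_banach, 'z::complex_normed_vector cdual) cblinfun"
    and P :: "nat \<Rightarrow> ('x, 'x) cblinfun"
    and k :: nat
  assumes "\<nexists>B. finite_dimensional_vector_space (scaleC :: complex \<Rightarrow> 'x \<Rightarrow> 'x) B"
    and "\<nexists>B. finite_dimensional_vector_space (scaleC :: complex \<Rightarrow> 'z cdual \<Rightarrow> 'z cdual) B"
    and "\<And>n. n \<ge> 1 \<Longrightarrow> norm (P n) \<le> 1"
    and "weak_star_tendsto (\<lambda>n. T o\<^sub>C P n) T"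
    and "k \<ge> 1"
  shows "(\<lambda>n. gelfand_number k (T o\<^sub>C P n)) \<longlonglongrightarrow> gelfand_number k T"
proof (rule order_tendstoI)
  \<comment> \<open>The sequence starts at index \<open>1\<close>, so \<open>P 0\<close> may have
    any norm; a bound that holds eventually suffices.\<close>
  have P: "\<forall>\<^sub>F n in sequentially. norm (P n) \<le> 1"
    using assms(3) eventually_sequentially by blast
  then have "\<forall>\<^sub>F n in sequentially. norm (T o\<^sub>C P n) \<le> norm T"
  proof eventually_elim
    case (elim n)
    then show ?case
      using norm_cblinfun_compose_le[of T "P n"] mult_left_mono[OF elim norm_ge_zero[of T]] by simp
  qed
  then show "\<forall>\<^sub>F n in sequentially. a < gelfand_number k (T o\<^sub>C P n)" if "a < gelfand_number k T" for a
    using gelfand_number_weak_star_lsc[OF assms(4) _ assms(5) that] by blast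
  show "\<forall>\<^sub>F n in sequentially. gelfand_number k (T o\<^sub>C P n) < a" if "gelfand_number k T < a" for a
    using P
  proof eventually_elim
    case (elim n)
    then show ?case using gelfand_number_compose_le[OF elim assms(5), of T] that by simp
  qed
qed

end
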